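(* Consider an instance of $(1 \mid p\mathrm{MA} \mid \sum_j C_j)$ with jobs $J_i=(p_i,\delta_i)$, $i=1,\dots,n$, initial level $\mathrm{ML}_0$ and maximum level $\mathrm{ML}^{\max}$, where $0\le\mathrm{ML}_0\le\mathrm{ML}^{\max}$, $\delta_i\le \mathrm{ML}^{\max}$ for all $i$, and $\mathrm{ML}_0<\sum_{i=1}^n\delta_i$. The algorithm $\mathcal{A}_1$ described below runs in $O(n\log n)$ time and outputs a feasible schedule whose total completion time is at most $2\cdot\mathrm{OPT}$, where $\mathrm{OPT}$ is the minimum total completion time over all feasible schedules.
   Context: Problem $(1 \mid p\mathrm{MA} \mid \sum_j C_j)$: A single machine has a maintenance level $\mathrm{ML}$, initially $\mathrm{ML}_0$, and a maximum maintenance level $\mathrm{ML}^{\max}$. Each job $J_i=(p_i,\delta_i)$ has a non-preemptive processing time $p_i\ge 0$ and a machine deterioration $\delta_i\ge 0$: processing $J_i$ when the level is $\mathrm{ML}$ leaves the level $\mathrm{ML}-\delta_i$. The level must be non-negative at every time point. A schedule processes all jobs one at a time, non-preemptively, starting at time $0$, and may interleave maintenance activities (MAs); an MA of duration $D$ occupies the machine for time $D$ and raises the level from $\mathrm{ML}$ to $\mathrm{ML}+\min\{D,\mathrm{ML}^{\max}-\mathrm{ML}\}$, where (partial maintenance) the duration may be any value in $[0,\mathrm{ML}^{\max}-\mathrm{ML}]$. A schedule is feasible if the level never becomes negative; $C_i$ is the completion time of $J_i$; the objective is $\sum_i C_i$. Algorithm $\mathcal{A}_1$: (1) Sort and re-index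 the jobs so that $p_1+\delta_1\le p_2+\delta_2\le\dots\le p_n+\delta_n$. (2) Let $k$ be the maximum index in $\{1,\dots,n\}$ with $\sum_{i=1}^{k-1}\delta_i\le\mathrm{ML}_0$; $J_k$ is the separation job. (3) Sort $J_1,\dots,J_{k-1}$ in non-decreasing order of processing time, obtaining $(J_{i_1},\dots,J_{i_{k-1}})$, and output the schedule (processed consecutively without idle time from time $0$) $(J_{i_1},\dots,J_{i_{k-1}};\ \mathrm{MA}_1, J_k;\ \mathrm{MA}_2, J_{k+1}, \mathrm{MA}_3, J_{k+2},\dots,\mathrm{MA}_{n-k+1},J_n)$, where $\mathrm{MA}_1$ has duration $\sum_{j=1}^k\delta_j-\mathrm{ML}_0$ and $\mathrm{MA}_i$ has duration $\delta_{k-1+i}$ for $i=2,\dots,n-k+1$. *)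

theory Defs
  imports Complex_Main "HOL-Library.Multiset" "HOL-Library.Landau_Symbols"
    "HOL-Library.Monad_Syntax"
begin

section \<open>Instances and schedules\<close>

text \<open>A job is the pair of its processing time and its machine deterioration. Jobs are referred to
  by their position \<open>i < n\<close> in the list \<open>js\<close> of all jobs, so that equal jobs stay distinguishable.\<close>

type_synonym job = "real \<times> real"

abbreviation proc :: "job list \<Rightarrow> nat \<Rightarrow> real" where
  "proc js i \<equiv> fst (js ! i)"

abbreviation det :: "job list \<Rightarrow> nat \<Rightarrow> real" where
  "det js i \<equiv> snd (js ! i)"

definition pMA_instance :: "job list \<Rightarrow> real \<Rightarrow> real \<Rightarrow> bool" where
  "pMA_instance js ML0 MLmax \<longleftrightarrow>
     (\<forall>i<length js. 0 \<le> proc js i \<and> 0 \<le> det js i \<and> det js i \<le> MLmax) \<and>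
     0 \<le> ML0 \<and> ML0 \<le> MLmax \<and> ML0 < (\<Sum>i<length js. det js i)"

text \<open>A schedule is the sequence of everything that occupies the time axis from time 0 on; inserted
  idle time is an explicit entry.\<close>

datatype activity = Job nat | MA real | Idle real

type_synonym schedule = "activity list"

fun duration :: "job list \<Rightarrow> activity \<Rightarrow> real" where
  "duration js (Job i) = proc js i"
| "duration js (MA D) = D"
| "duration js (Idle d) = d"

fun next_level :: "job list \<Rightarrow> real \<Rightarrow> real \<Rightarrow> activity \<Rightarrow> real" where
  "next_level js MLmax ML (Job i) = ML - det js i"
| "next_level js MLmax ML (MA D) = ML + min D (MLmax - ML)"
| "next_level js MLmax ML (Idle d) = ML"

definition level :: "job list \<Rightarrow> real \<Rightarrow> real \<Rightarrow> schedule \<Rightarrow> real" where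
  "level js MLmax ML0 S = foldl (next_level js MLmax) ML0 S"

fun admissible :: "real \<Rightarrow> real \<Rightarrow> activity \<Rightarrow> bool" where
  "admissible MLmax ML (Job i) \<longleftrightarrow> True"
| "admissible MLmax ML (MA D) \<longleftrightarrow> 0 \<le> D \<and> D \<le> MLmax - ML"
| "admissible MLmax ML (Idle d) \<longleftrightarrow> 0 \<le> d"

text \<open>Within one activity the level moves monotonically, so non-negativity at every time point is
  non-negativity at the boundaries between activities.\<close>

definition feasible :: "job list \<Rightarrow> real \<Rightarrow> real \<Rightarrow> schedule \<Rightarrow> bool" where
  "feasible js ML0 MLmax S \<longleftrightarrow>
     (\<forall>i. count_list S (Job i) = (if i < length js then 1 else 0)) \<and>
     (\<forall>k<length S. admissible MLmax (level js MLmax ML0 (take k S)) (S ! k)) \<and>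
     (\<forall>k\<le>length S. 0 \<le> level js MLmax ML0 (take k S))"

definition completion_time :: "job list \<Rightarrow> schedule \<Rightarrow> nat \<Rightarrow> real" where
  "completion_time js S i =
     (\<Sum>a\<leftarrow>takeWhile (\<lambda>a. a \<noteq> Job i) S. duration js a) + proc js i"

definition total_completion_time :: "job list \<Rightarrow> schedule \<Rightarrow> real" where
  "total_completion_time js S = (\<Sum>i<length js. completion_time js S i)"

definition OPT :: "job list \<Rightarrow> real \<Rightarrow> real \<Rightarrow> real" where
  "OPT js ML0 MLmax =
     (LEAST c. \<exists>S. feasible js ML0 MLmax S \<and> c = total_completion_time js S)"


section \<open>The algorithm\<close>

text \<open>The schedules that the algorithm may output. Both sorting steps leave the order of ties open,
  hence a relation: \<open>\<sigma>\<close> is the re-indexing, i.e. \<open>\<sigma> ! (j - 1)\<close> is the job called $J_j$ after the first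
  step, and \<open>\<tau>\<close> is the order of the jobs before the separation job \<open>\<sigma> ! (k - 1)\<close>.\<close>

definition A1_output :: "job list \<Rightarrow> real \<Rightarrow> schedule \<Rightarrow> bool" where
  "A1_output js ML0 S \<longleftrightarrow>
     (\<exists>\<sigma> \<tau> k.
        mset \<sigma> = mset [0..<length js] \<and>
        sorted (map (\<lambda>i. proc js i + det js i) \<sigma>) \<and>
        k = Max {k \<in> {1..length js}. (\<Sum>i\<leftarrow>take (k - 1) \<sigma>. det js i) \<le> ML0} \<and>
        mset \<tau> = mset (take (k - 1) \<sigma>) \<and>
        sorted (map (proc js) \<tau>) \<and>
        S = map Job \<tau> @
            [MA ((\<Sum>i\<leftarrow>take k \<sigma>. det js i) - ML0), Job (\<sigma> ! (k - 1))] @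
            concat (map (\<lambda>i. [MA (det js i), Job i]) (drop k \<sigma>)))"


section \<open>Implementation with running time\<close>

text \<open>Computations that carry their number of elementary steps. The model is a unit-cost real RAM:
  every function call, every addition or subtraction of reals and every comparison of reals takes
  one step. Besides these, a call performs only a bounded number of constructor applications,
  pattern matches and successor operations.\<close>

datatype 'a timed = Timed (result: 'a) (steps: nat)

definition return_timed :: "'a \<Rightarrow> 'a timed" where
  "return_timed x = Timed x 0"

definition bind_timed :: "'a timed \<Rightarrow> ('a \<Rightarrow> 'b timed) \<Rightarrow> 'b timed" where
  "bind_timed m f = Timed (result (f (result m))) (steps m + steps (f (result m)))"

adhoc_overloading Monad_Syntax.bind \<rightleftharpoons> bind_timed

lemma bind_timed_cong [fundef_cong]:
  assumes "m = m'" and "\<And>x. x = result m' \<Longrightarrow> f x = f' x"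
  shows "bind_timed m f = bind_timed m' f'"
  using assms by (simp add: bind_timed_def)

definition call :: "unit timed" where
  "call = Timed () 1"

definition add_timed :: "real \<Rightarrow> real \<Rightarrow> real timed" where
  "add_timed x y = Timed (x + y) 1"

definition sub_timed :: "real \<Rightarrow> real \<Rightarrow> real timed" where
  "sub_timed x y = Timed (x - y) 1"

definition le_timed :: "real \<Rightarrow> real \<Rightarrow> bool timed" where
  "le_timed x y = Timed (x \<le> y) 1"

fun split_timed :: "'a list \<Rightarrow> ('a list \<times> 'a list) timed" where
  "split_timed [] = do { call; return_timed ([], []) }"
| "split_timed (x # xs) = do {
     call;
     (ys, zs) \<leftarrow> split_timed xs;
     return_timed (x # zs, ys) }"

fun merge_timed :: "('a \<Rightarrow> real timed) \<Rightarrow> 'a list \<Rightarrow> 'a list \<Rightarrow> 'a list timed" where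
  "merge_timed key [] ys = do { call; return_timed ys }"
| "merge_timed key (x # xs) [] = do { call; return_timed (x # xs) }"
| "merge_timed key (x # xs) (y # ys) = do {
     call;
     a \<leftarrow> key x;
     b \<leftarrow> key y;
     c \<leftarrow> le_timed a b;
     if c then do { zs \<leftarrow> merge_timed key xs (y # ys); return_timed (x # zs) }
     else do { zs \<leftarrow> merge_timed key (x # xs) ys; return_timed (y # zs) } }"

lemma length_split_timed:
  "length (fst (result (split_timed xs))) = (length xs + 1) div 2 \<and>
   length (snd (result (split_timed xs))) = length xs div 2"
  by (induction xs)
     (auto simp: bind_timed_def return_timed_def call_def split: prod.splits)

function msort_timed :: "('a \<Rightarrow> real timed) \<Rightarrow> 'a list \<Rightarrow> 'a list timed" where
  "msort_timed key [] = do { call; return_timed [] }"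
| "msort_timed key [x] = do { call; return_timed [x] }"
| "msort_timed key (x # y # xs) = do {
     call;
     (us, vs) \<leftarrow> split_timed (x # y # xs);
     us' \<leftarrow> msort_timed key us;
     vs' \<leftarrow> msort_timed key vs;
     merge_timed key us' vs' }"
  by pat_completeness auto
termination
proof (relation "measure (\<lambda>(key, xs). length xs)", goal_cases)
  case 1
  show ?case by simp
next
  case (2 key x y xs u p us vs)
  then show ?case
    using length_split_timed[of "x # y # xs"] by (cases "result (split_timed (x # y # xs))") auto
next
  case (3 key x y xs u p us vs us')
  then show ?case
    using length_split_timed[of "x # y # xs"] by (cases "result (split_timed (x # y # xs))") auto
qed

text \<open>The implementation handles the job \<open>(p, \<delta>)\<close> at position \<open>i\<close> as the triple \<open>(i, p, \<delta>)\<close>.\<close>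

type_synonym ijob = "nat \<times> real \<times> real"

fun index_timed :: "nat \<Rightarrow> job list \<Rightarrow> ijob list timed" where
  "index_timed i [] = do { call; return_timed [] }"
| "index_timed i ((p, d) # js) = do {
     call;
     xs \<leftarrow> index_timed (Suc i) js;
     return_timed ((i, p, d) # xs) }"

fun sum_key :: "ijob \<Rightarrow> real timed" where
  "sum_key (i, p, d) = do { call; add_timed p d }"

fun proc_key :: "ijob \<Rightarrow> real timed" where
  "proc_key (i, p, d) = do { call; return_timed p }"

text \<open>Splits the sorted jobs into those before the separation job and those from the separation job
  on; the third component is the total deterioration of the former. The argument \<open>s\<close> is the total
  deterioration of the jobs already passed.\<close>

fun separate_timed :: "real \<Rightarrow> real \<Rightarrow> ijob list \<Rightarrow> (ijob list \<times> ijob list \<times> real) timed" where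
  "separate_timed ML0 s [] = do { call; return_timed ([], [], s) }"
| "separate_timed ML0 s [x] = do { call; return_timed ([], [x], s) }"
| "separate_timed ML0 s ((i, p, d) # y # xs) = do {
     call;
     s' \<leftarrow> add_timed s d;
     c \<leftarrow> le_timed s' ML0;
     if c then do {
       (us, vs, t) \<leftarrow> separate_timed ML0 s' (y # xs);
       return_timed ((i, p, d) # us, vs, t) }
     else return_timed ([], (i, p, d) # y # xs, s) }"

fun emit_jobs_timed :: "ijob list \<Rightarrow> schedule \<Rightarrow> schedule timed" where
  "emit_jobs_timed [] S = do { call; return_timed S }"
| "emit_jobs_timed ((i, p, d) # xs) S = do {
     call;
     S' \<leftarrow> emit_jobs_timed xs S;
     return_timed (Job i # S') }"

fun emit_MA_jobs_timed :: "ijob list \<Rightarrow> schedule timed" where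
  "emit_MA_jobs_timed [] = do { call; return_timed [] }"
| "emit_MA_jobs_timed ((i, p, d) # xs) = do {
     call;
     S \<leftarrow> emit_MA_jobs_timed xs;
     return_timed (MA d # Job i # S) }"

fun emit_from_separation_timed :: "real \<Rightarrow> real \<Rightarrow> ijob list \<Rightarrow> schedule timed" where
  "emit_from_separation_timed ML0 s [] = do { call; return_timed [] }"
| "emit_from_separation_timed ML0 s ((i, p, d) # xs) = do {
     call;
     t \<leftarrow> add_timed s d;
     D \<leftarrow> sub_timed t ML0;
     S \<leftarrow> emit_MA_jobs_timed xs;
     return_timed (MA D # Job i # S) }"

definition A1 :: "job list \<Rightarrow> real \<Rightarrow> schedule timed" where
  "A1 js ML0 = do {
     call;
     xs \<leftarrow> index_timed 0 js;
     ys \<leftarrow> msort_timed sum_key xs;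
     (us, vs, s) \<leftarrow> separate_timed ML0 0 ys;
     us' \<leftarrow> msort_timed proc_key us;
     S \<leftarrow> emit_from_separation_timed ML0 s vs;
     emit_jobs_timed us' S }"

end

theory Submission
  imports Defs "HOL-Real_Asymp.Real_Asymp"
begin

text \<open>For a fixed order of the jobs it is best to maintain as late as possible. The \<open>j\<close>-th job of the order
  then completes at $P_j + \max\{0, \Delta_j - \mathrm{ML}_0\}$, where $P_j$ and $\Delta_j$ are the total
  processing time and deterioration of the first \<open>j\<close> jobs; since there are finitely many orders, the
  optimum is attained. The output of the algorithm is the best schedule for its own order. Its first
  $k - 1$ jobs need no maintenance and are processed shortest first, so their completion times sum
  up to at most the sum of the completion times of the same jobs in an optimal schedule. For
  $j \ge k$ its \<open>j\<close>-th job completes at $P_j + \Delta_j - \mathrm{ML}_0$, and sorting by $p + \delta$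
  minimises $P_j + \Delta_j$ over all orders, so the \<open>j\<close>-th job of an optimal schedule completes no
  earlier. Each of the two parts therefore costs at most $\mathrm{OPT}$.\<close>

section \<open>Prefix sums of sorted lists\<close>

text \<open>The head \<open>y\<close> is a least element of \<open>ys\<close>, so it can be charged
  to one element of \<open>A\<close>; the rest of \<open>A\<close> fits into the tail.\<close>

lemma sum_list_take_sorted_le_sum_mset:
  fixes ys :: "'a :: {linorder, ordered_comm_monoid_add} list"
  assumes "sorted ys" and "A \<subseteq># mset ys"
  shows "sum_list (take (size A) ys) \<le> sum_mset A"
  using assms
proof (induction ys arbitrary: A)
  case Nil
  then show ?case by simp
next
  case (Cons y ys)
  show ?case
  proof (cases "A = {#}")
    case False
    \<comment> \<open>If \<open>y\<close> occurs in \<open>A\<close>, it is charged to itself, so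
      that the tail covers the rest; otherwise any element of \<open>A\<close> will do.\<close>
    define a where "a = (if y \<in># A then y else (SOME a. a \<in># A))"
    have a: "a \<in># A"
      using False by (auto simp: a_def some_in_eq)
    then obtain B where B: "A = add_mset a B"
      by (meson multi_member_split)
    have "y \<le> a"
      using mset_subset_eqD[OF Cons.prems(2) a] Cons.prems(1) by auto
    moreover have "B \<subseteq># mset ys"
    proof (cases "y \<in># A")
      case True
      then have "a = y"
        by (simp add: a_def)
      then show ?thesis
        using Cons.prems(2) by (simp add: B)
    next
      case False
      then have "A \<subseteq># mset ys"
        using Cons.prems(2)
        by (metis (no_types) add_mset_add_single add_mset_remove_trivial diff_single_trivial
            mset.simps(2) subset_eq_diff_conv)
      moreover have "B \<subseteq># A"
        by (simp add: B)
      ultimately show ?thesis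
        by (rule subset_mset.order_trans[rotated])
    qed
    ultimately show ?thesis
      using Cons by (auto simp: B intro!: add_mono)
  qed simp
qed

text \<open>Here \<open>A\<close> consists of the first \<open>j\<close> values of
  \<open>xs\<close>. The lemma serves twice: for \<open>proc\<close> and for the sum of
  \<open>proc\<close> and \<open>det\<close>.\<close>

lemma sum_list_take_sorted_le:
  fixes f :: "'a \<Rightarrow> 'b :: {linorder, ordered_comm_monoid_add}"
  assumes "mset xs = mset ys" and "sorted (map f ys)"
  shows "(\<Sum>y\<leftarrow>take j ys. f y) \<le> (\<Sum>x\<leftarrow>take j xs. f x)"
proof -
  have len: "length xs = length ys"
    using assms(1) mset_eq_length by blast
  have "mset (take j (map f xs)) \<subseteq># mset (map f ys)"
    using assms(1)
    by (metis append_take_drop_id mset_append mset_map mset_subset_eq_add_left)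
  then have "sum_list (take (size (mset (take j (map f xs)))) (map f ys))
    \<le> sum_mset (mset (take j (map f xs)))"
    using assms(2) by (rule sum_list_take_sorted_le_sum_mset[rotated])
  \<comment> \<open>For \<open>j\<close> beyond the length, both prefixes are the whole
    list.\<close>
  moreover have "take (size (mset (take j (map f xs)))) (map f ys) = take j (map f ys)"
    using len by (cases "j \<le> length ys") auto
  ultimately show ?thesis
    by (simp add: take_map sum_mset_sum_list flip: mset_map)
qed

lemma sum_list_map_mset_eq:
  fixes f :: "'a \<Rightarrow> 'b :: comm_monoid_add"
  assumes "mset xs = mset ys"
  shows "(\<Sum>x\<leftarrow>xs. f x) = (\<Sum>y\<leftarrow>ys. f y)"
  by (metis assms mset_map sum_mset_sum_list)

lemma sum_list_take_mono:
  fixes f :: "'a \<Rightarrow> real"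
  assumes "\<forall>x\<in>set xs. 0 \<le> f x" and "i \<le> j"
  shows "(\<Sum>x\<leftarrow>take i xs. f x) \<le> (\<Sum>x\<leftarrow>take j xs. f x)"
proof -
  obtain d where "j = i + d"
    using assms(2) le_Suc_ex by blast
  then have "take j xs = take i xs @ take d (drop i xs)"
    by (simp add: take_add)
  moreover have "0 \<le> (\<Sum>x\<leftarrow>take d (drop i xs). f x)"
    using assms(1) by (intro sum_list_nonneg) (auto dest!: in_set_takeD in_set_dropD)
  ultimately show ?thesis by simp
qed

section \<open>The cost of a job order\<close>

text \<open>\<open>P\<close> is the processing time so far and \<open>N\<close> the initial level minus the deterioration so far, i.e.
  the level without any maintenance, which may be negative.\<close>

fun order_cost :: "job list \<Rightarrow> real \<Rightarrow> real \<Rightarrow> nat list \<Rightarrow> real" where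
  "order_cost js P N [] = 0"
| "order_cost js P N (i # \<pi>) = P + proc js i + max 0 (det js i - N) +
     order_cost js (P + proc js i) (N - det js i) \<pi>"

text \<open>Allows two orders to be compared position by position; positions count from 0, hence
  \<open>Suc j\<close>.\<close>

lemma order_cost_eq_sum:
  "order_cost js P N \<pi> = (\<Sum>j<length \<pi>. P + (\<Sum>i\<leftarrow>take (Suc j) \<pi>. proc js i) +
     max 0 ((\<Sum>i\<leftarrow>take (Suc j) \<pi>. det js i) - N))"
  by (induction \<pi> arbitrary: P N)
     (simp_all add: sum.lessThan_Suc_shift algebra_simps del: sum.lessThan_Suc)

section \<open>Schedules, their job orders and their costs\<close>

fun jobs_of :: "schedule \<Rightarrow> nat list" where
  "jobs_of [] = []"
| "jobs_of (Job i # S) = i # jobs_of S"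
| "jobs_of (MA D # S) = jobs_of S"
| "jobs_of (Idle d # S) = jobs_of S"

text \<open>The clock \<open>t\<close> is an argument, so that the total cost can be bounded by
  induction along the schedule.\<close>

fun schedule_cost :: "job list \<Rightarrow> real \<Rightarrow> schedule \<Rightarrow> real" where
  "schedule_cost js t [] = 0"
| "schedule_cost js t (Job i # S) = t + proc js i + schedule_cost js (t + proc js i) S"
| "schedule_cost js t (MA D # S) = schedule_cost js (t + D) S"
| "schedule_cost js t (Idle d # S) = schedule_cost js (t + d) S"

lemma completion_time_simps:
  "completion_time js (Job i # S) i = proc js i"
  "i \<noteq> j \<Longrightarrow> completion_time js (Job i # S) j = proc js i + completion_time js S j"
  "completion_time js (MA D # S) j = D + completion_time js S j"
  "completion_time js (Idle D # S) j = D + completion_time js S j"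
  by (auto simp: completion_time_def)

text \<open>By distinctness the head job differs from all later ones, so it merely delays them by
  its processing time.\<close>

lemma sum_completion_time:
  assumes "distinct (jobs_of S)"
  shows "(\<Sum>i\<in>set (jobs_of S). t + completion_time js S i) = schedule_cost js t S"
  using assms
proof (induction js t S rule: schedule_cost.induct)
  case (2 js t i S)
  have "(\<Sum>j\<in>set (jobs_of S). t + completion_time js (Job i # S) j) =
        (\<Sum>j\<in>set (jobs_of S). t + proc js i + completion_time js S j)"
  proof (intro sum.cong refl)
    fix j assume "j \<in> set (jobs_of S)"
    then have "i \<noteq> j"
      using 2(2) by auto
    then show "t + completion_time js (Job i # S) j = t + proc js i + completion_time js S j"
      by (simp add: completion_time_simps)
  qed
  then show ?case
    using 2 by (simp add: completion_time_simps)
qed (simp_all add: completion_time_simps algebra_simps)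

lemma count_list_jobs_of: "count_list (jobs_of S) i = count_list S (Job i)"
  by (induction S rule: jobs_of.induct) auto

lemma count_list_eq_mset_iff:
  "(\<forall>i. count_list S (Job i) = (if i < n then 1 else 0)) \<longleftrightarrow> mset (jobs_of S) = mset [0..<n]"
proof -
  have "count (mset [0..<n]) i = (if i < n then 1 else 0)" for i
    using distinct_count_atmost_1[of "[0..<n]"] by auto
  then show ?thesis
    by (simp add: multiset_eq_iff count_mset count_list_jobs_of)
qed

lemma mset_eq_upt_imp:
  assumes "mset \<pi> = mset [0..<n]"
  shows "distinct \<pi>" "set \<pi> = {..<n}" "length \<pi> = n"
  by (simp_all add: mset_eq_imp_distinct_iff[OF assms] mset_eq_setD[OF assms]
      mset_eq_length[OF assms] atLeast0LessThan)

lemma total_completion_time_eq: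
  assumes "mset (jobs_of S) = mset [0..<length js]"
  shows "total_completion_time js S = schedule_cost js 0 S"
  using sum_completion_time[of S 0 js] mset_eq_upt_imp[OF assms]
  by (simp add: total_completion_time_def)

text \<open>The level conditions of \<open>feasible\<close> from an arbitrary level, as a recursion
  that fits induction.\<close>

fun level_feasible :: "job list \<Rightarrow> real \<Rightarrow> real \<Rightarrow> schedule \<Rightarrow> bool" where
  "level_feasible js MLmax L [] \<longleftrightarrow> 0 \<le> L"
| "level_feasible js MLmax L (a # S) \<longleftrightarrow>
     0 \<le> L \<and> admissible MLmax L a \<and> level_feasible js MLmax (next_level js MLmax L a) S"

lemma level_feasible_iff:
  "level_feasible js MLmax L S \<longleftrightarrow>
     (\<forall>k<length S. admissible MLmax (level js MLmax L (take k S)) (S ! k)) \<and>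
     (\<forall>k\<le>length S. 0 \<le> level js MLmax L (take k S))"
proof (induction S arbitrary: L)
  case Nil
  then show ?case by (simp add: level_def)
next
  case (Cons a S)
  show ?case
    unfolding level_feasible.simps Cons.IH
    by (auto simp: All_less_Suc2 level_def less_Suc_eq_le[symmetric])
qed

lemma feasible_iff:
  "feasible js ML0 MLmax S \<longleftrightarrow>
     mset (jobs_of S) = mset [0..<length js] \<and> level_feasible js MLmax ML0 S"
  unfolding feasible_def level_feasible_iff count_list_eq_mset_iff by simp

lemma level_feasible_nonneg: "level_feasible js MLmax L S \<Longrightarrow> 0 \<le> L"
  by (cases S) auto

text \<open>Invariant: \<open>t - P\<close> is at least the maintenance done so far, hence at least \<open>L - N\<close>.\<close>

lemma order_cost_le_schedule_cost:
  assumes "level_feasible js MLmax L S" and "P \<le> t" and "P + L - N \<le> t"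
  shows "order_cost js P N (jobs_of S) \<le> schedule_cost js t S"
  using assms
proof (induction S arbitrary: L P t N rule: jobs_of.induct)
  case (2 i S)
  have "order_cost js (P + proc js i) (N - det js i) (jobs_of S)
      \<le> schedule_cost js (t + proc js i) S"
    using 2 by (intro "2.IH"[of "L - det js i"]) auto
  \<comment> \<open>Feasibility after the job gives \<open>det js i \<le> L\<close>, so the deficit
    \<open>det js i - N\<close> is covered by \<open>t - P\<close>.\<close>
  moreover have "0 \<le> L - det js i"
    using 2(2) level_feasible_nonneg[of js MLmax "L - det js i" S] by simp
  ultimately show ?case
    using 2(3,4) by simp
next
  case (3 D S)
  \<comment> \<open>The clock advances by \<open>D \<ge> 0\<close> and the level by at most
    \<open>D\<close>, so the invariant survives.\<close>
  then show ?case
    by (auto intro!: "3.IH"[of "L + min D (MLmax - L)"])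
next
  case (4 d S)
  then show ?case
    by (auto intro!: "4.IH"[of L])
qed simp

section \<open>Latest possible maintenance and the optimum\<close>

text \<open>Maintenance that is done only for the next job and leaves the level 0 after it. Both rules apply
  if \<open>L = det js i\<close>, because the algorithm also emits maintenance activities of duration 0.\<close>

inductive tight :: "job list \<Rightarrow> real \<Rightarrow> nat list \<Rightarrow> schedule \<Rightarrow> bool" for js where
  Nil: "tight js L [] []"
| Job: "det js i \<le> L \<Longrightarrow> tight js (L - det js i) \<pi> S \<Longrightarrow> tight js L (i # \<pi>) (Job i # S)"
| MA: "L \<le> det js i \<Longrightarrow> tight js 0 \<pi> S \<Longrightarrow>
    tight js L (i # \<pi>) (MA (det js i - L) # Job i # S)"

lemma tight_exists: "\<exists>S. tight js L \<pi> S"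
  by (induction \<pi> arbitrary: L) (auto intro: tight.intros, metis linear tight.Job tight.MA)

lemma tight_jobs_of: "tight js L \<pi> S \<Longrightarrow> jobs_of S = \<pi>"
  by (induction rule: tight.induct) auto

text \<open>Each activity raises the level exactly to \<open>det js i\<close>, which is at most
  \<open>MLmax\<close>, and the job then takes it to 0.\<close>

lemma tight_level_feasible:
  assumes "tight js L \<pi> S" and "0 \<le> L" "L \<le> MLmax"
    and "\<forall>i\<in>set \<pi>. 0 \<le> det js i \<and> det js i \<le> MLmax"
  shows "level_feasible js MLmax L S"
  using assms by (induction rule: tight.induct) auto

text \<open>The maintenance done so far is \<open>max 0 (- N)\<close>, exactly what was missing, so
  the clock shows \<open>P + max 0 (- N)\<close>.\<close>

lemma tight_schedule_cost:
  assumes "tight js L \<pi> S" and "L = max 0 N" and "\<forall>i\<in>set \<pi>. 0 \<le> det js i"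
  shows "schedule_cost js (P + max 0 (- N)) S = order_cost js P N \<pi>"
  using assms
proof (induction arbitrary: P N rule: tight.induct)
  case (Job i L \<pi> S)
  have "0 \<le> det js i"
    using Job.prems by simp
  \<comment> \<open>If \<open>N < 0\<close>, then \<open>L = 0\<close> and this rule forces
    \<open>det js i = 0\<close>; otherwise \<open>det js i \<le> N\<close> and no maintenance has
    been done.\<close>
  with Job.hyps(1) Job.prems(1)
  have "L - det js i = max 0 (N - det js i)" "max 0 (det js i - N) = max 0 (- N)"
    by (auto simp: max_def split: if_splits)
  with Job.IH[of "N - det js i" "P + proc js i"] Job.prems(2) show ?case
    by (simp add: algebra_simps)
next
  case (MA L i \<pi> S)
  have "max 0 (N - det js i) = 0" "max 0 (det js i - N) = det js i - N"
    using MA.hyps(1) MA.prems(1) by auto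
  \<comment> \<open>For \<open>0 \<le> N\<close> the activity lasts \<open>det js i - N\<close>;
    otherwise it lasts \<open>det js i\<close>, after \<open>- N\<close> spent earlier.\<close>
  with MA.IH[of "N - det js i" "P + proc js i"] MA.prems show ?case
    by (cases "0 \<le> N") (simp_all add: algebra_simps)
qed simp

lemma pMA_instanceD:
  assumes "pMA_instance js ML0 MLmax" and "mset \<pi> = mset [0..<length js]"
  shows "\<forall>i\<in>set \<pi>. 0 \<le> proc js i \<and> 0 \<le> det js i \<and> det js i \<le> MLmax"
    and "0 \<le> ML0" "ML0 \<le> MLmax" "ML0 < (\<Sum>i\<leftarrow>\<pi>. det js i)" "\<pi> \<noteq> []"
proof -
  note perm = mset_eq_upt_imp[OF assms(2)]
  show "\<forall>i\<in>set \<pi>. 0 \<le> proc js i \<and> 0 \<le> det js i \<and> det js i \<le> MLmax"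
    "0 \<le> ML0" "ML0 \<le> MLmax"
    using assms(1) perm by (auto simp: pMA_instance_def)
  show *: "ML0 < (\<Sum>i\<leftarrow>\<pi>. det js i)"
    using assms(1) perm by (simp add: pMA_instance_def sum_list_distinct_conv_sum_set)
  show "\<pi> \<noteq> []"
    using * \<open>0 \<le> ML0\<close> by auto
qed

lemma tight_feasible:
  assumes "pMA_instance js ML0 MLmax" and "mset \<pi> = mset [0..<length js]" and "tight js ML0 \<pi> S"
  shows "feasible js ML0 MLmax S" and "total_completion_time js S = order_cost js 0 ML0 \<pi>"
proof -
  note inst = pMA_instanceD[OF assms(1,2)]
  show "feasible js ML0 MLmax S"
    using tight_level_feasible[OF assms(3)] inst assms(2) tight_jobs_of[OF assms(3)]
    by (auto simp: feasible_iff)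
  show "total_completion_time js S = order_cost js 0 ML0 \<pi>"
    using tight_schedule_cost[OF assms(3), of ML0 0] inst total_completion_time_eq[of S js]
      assms(2) tight_jobs_of[OF assms(3)] by auto
qed

text \<open>A \<open>LEAST\<close> over reals is meaningful only if attained. A tight schedule
  attains the cost of the best order, and a feasible schedule costs at least as much as its own
  order.\<close>

lemma OPT_attained:
  assumes "pMA_instance js ML0 MLmax"
  obtains \<pi> where "mset \<pi> = mset [0..<length js]" and "OPT js ML0 MLmax = order_cost js 0 ML0 \<pi>"
proof -
  let ?X = "{\<pi>. mset \<pi> = mset [0..<length js]}"
  have "finite ?X"
    by (rule mset_eq_finite)
  moreover have "?X \<noteq> {}"
    by blast
  ultimately obtain \<pi> where \<pi>: "\<pi> \<in> ?X"
    and min: "\<And>\<rho>. \<rho> \<in> ?X \<Longrightarrow> order_cost js 0 ML0 \<pi> \<le> order_cost js 0 ML0 \<rho>"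
    by (metis arg_min_if_finite(1) arg_min_least)
  obtain S where S: "tight js ML0 \<pi> S"
    using tight_exists by blast
  have "OPT js ML0 MLmax = order_cost js 0 ML0 \<pi>"
    unfolding OPT_def
  proof (rule Least_equality)
    show "\<exists>S. feasible js ML0 MLmax S \<and> order_cost js 0 ML0 \<pi> = total_completion_time js S"
      using tight_feasible[OF assms _ S] \<pi> by auto
  next
    fix c
    assume "\<exists>S. feasible js ML0 MLmax S \<and> c = total_completion_time js S"
    then obtain S' where S': "feasible js ML0 MLmax S'" "c = total_completion_time js S'"
      by blast
    have "order_cost js 0 ML0 \<pi> \<le> order_cost js 0 ML0 (jobs_of S')"
      using S'(1) by (intro min) (simp add: feasible_iff)
    also have "\<dots> \<le> schedule_cost js 0 S'"
      using S'(1) by (intro order_cost_le_schedule_cost) (auto simp: feasible_iff)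
    also have "\<dots> = c"
      using S' by (simp add: feasible_iff total_completion_time_eq)
    finally show "order_cost js 0 ML0 \<pi> \<le> c" .
  qed
  with \<pi> that show thesis by simp
qed

section \<open>The approximation guarantee\<close>

text \<open>Prefix sums are monotone, so the admissible indices form an initial segment and its end
  can be recognised locally, as a left-to-right scan does.\<close>

lemma separation_index_iff:
  fixes f :: "'a \<Rightarrow> real"
  assumes "\<forall>x\<in>set xs. 0 \<le> f x" and "xs \<noteq> []" and "0 \<le> b"
  shows "k = Max {k \<in> {1..length xs}. (\<Sum>x\<leftarrow>take (k - 1) xs. f x) \<le> b} \<longleftrightarrow>
    1 \<le> k \<and> k \<le> length xs \<and> (\<Sum>x\<leftarrow>take (k - 1) xs. f x) \<le> b \<and>
    (k < length xs \<longrightarrow> b < (\<Sum>x\<leftarrow>take k xs. f x))"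
    (is "k = Max ?K \<longleftrightarrow> ?R k")
proof -
  have fin: "finite ?K" by simp
  have "1 \<in> ?K"
    using assms(2,3) by (auto simp: Suc_le_eq)
  then have ne: "?K \<noteq> {}" by blast
  have R_Max: "?R (Max ?K)"
  proof -
    have "Max ?K \<in> ?K"
      using fin ne by (rule Max_in)
    moreover have "b < (\<Sum>x\<leftarrow>take (Max ?K) xs. f x)" if "Max ?K < length xs"
    proof (rule ccontr)
      assume "\<not> ?thesis"
      \<comment> \<open>Index \<open>Suc (Max ?K)\<close> tests the prefix of length
        \<open>Max ?K\<close>.\<close>
      then have "Suc (Max ?K) \<in> ?K"
        using that by simp
      then show False
        using Max_ge[OF fin] by fastforce
    qed
    ultimately show ?thesis by simp
  qed
  have Max_eq: "k = Max ?K" if R: "?R k"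
  proof (rule sym, rule Max_eqI[OF fin])
    show "k \<in> ?K" using R by simp
    fix l assume l: "l \<in> ?K"
    show "l \<le> k"
    proof (rule ccontr)
      assume "\<not> l \<le> k"
      \<comment> \<open>Now \<open>k \<le> l - 1\<close>, so the prefix tested for \<open>l\<close>
        already exceeds \<open>b\<close>.\<close>
      then have "(\<Sum>x\<leftarrow>take k xs. f x) \<le> (\<Sum>x\<leftarrow>take (l - 1) xs. f x)"
        by (intro sum_list_take_mono assms) auto
      then show False
        using R l \<open>\<not> l \<le> k\<close> by auto
    qed
  qed
  show ?thesis
  proof
    assume k: "k = Max ?K"
    show "?R k"
      unfolding k by (fact R_Max)
  qed (rule Max_eq)
qed

text \<open>Non-negative deteriorations keep every partial sum below the total, so
  \<open>tight.Job\<close> applies throughout \<open>\<tau>\<close>.\<close>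

lemma tight_map_Job_append:
  assumes "(\<Sum>i\<leftarrow>\<tau>. det js i) \<le> L" and "\<forall>i\<in>set \<tau>. 0 \<le> det js i"
    and "tight js (L - (\<Sum>i\<leftarrow>\<tau>. det js i)) \<pi> S"
  shows "tight js L (\<tau> @ \<pi>) (map Job \<tau> @ S)"
  using assms
proof (induction \<tau> arbitrary: L)
  case (Cons i \<tau>)
  have "0 \<le> (\<Sum>i\<leftarrow>\<tau>. det js i)"
    using Cons.prems(2) by (intro sum_list_nonneg) auto
  then show ?case
    using Cons.prems by (auto intro!: tight.Job Cons.IH simp: algebra_simps)
qed simp

lemma tight_concat_MA_Job:
  assumes "\<forall>i\<in>set \<pi>. 0 \<le> det js i"
  shows "tight js 0 \<pi> (concat (map (\<lambda>i. [MA (det js i), Job i]) \<pi>))"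
  using assms
proof (induction \<pi>)
  case (Cons i \<pi>)
  then show ?case
    using tight.MA[of 0 js i \<pi>] by simp
qed (simp add: tight.Nil)

text \<open>Deleting jobs and maintenance only makes the remaining jobs earlier. \<open>P'\<close>
  lags behind \<open>P\<close> because deleted jobs advance only \<open>P\<close>.\<close>

lemma order_cost_filter_le:
  assumes "\<forall>i\<in>set \<pi>. 0 \<le> proc js i" and "P' \<le> P" and "0 \<le> P"
  shows "(\<Sum>j<length (filter Q \<pi>). P' + (\<Sum>i\<leftarrow>take (Suc j) (filter Q \<pi>). proc js i))
    \<le> order_cost js P N \<pi>"
  using assms
proof (induction \<pi> arbitrary: P P' N)
  case (Cons i \<pi>)
  have "(\<Sum>j<length (filter Q \<pi>). P'' + (\<Sum>i\<leftarrow>take (Suc j) (filter Q \<pi>). proc js i))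
    \<le> order_cost js (P + proc js i) (N - det js i) \<pi>" if "P'' \<le> P + proc js i" for P''
    using Cons.prems that by (intro Cons.IH) auto
  \<comment> \<open>The first instance is for a deleted head, the second for a kept one.\<close>
  from this[of P'] this[of "P' + proc js i"] Cons.prems show ?case
    by (auto simp: sum.lessThan_Suc_shift algebra_simps simp del: sum.lessThan_Suc)
qed simp

text \<open>Here \<open>m\<close> is \<open>k - 1\<close>. Positions before and from
  \<open>m\<close> on are bounded separately, each by the full cost of \<open>\<pi>\<close>.\<close>

lemma order_cost_le_twice:
  assumes inst: "pMA_instance js ML0 MLmax"
    and \<sigma>: "mset \<sigma> = mset [0..<length js]" "sorted (map (\<lambda>i. proc js i + det js i) \<sigma>)"
    and \<tau>: "mset \<tau> = mset (take m \<sigma>)" "sorted (map (proc js) \<tau>)"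
    and m: "m < length js" "(\<Sum>i\<leftarrow>take m \<sigma>. det js i) \<le> ML0"
      "ML0 \<le> (\<Sum>i\<leftarrow>take (Suc m) \<sigma>. det js i)"
    and \<pi>: "mset \<pi> = mset [0..<length js]"
  shows "order_cost js 0 ML0 (\<tau> @ drop m \<sigma>) \<le> 2 * order_cost js 0 ML0 \<pi>"
proof -
  let ?n = "length js" and ?\<rho> = "\<tau> @ drop m \<sigma>"
  let ?P = "\<lambda>\<pi> j. \<Sum>i\<leftarrow>take (Suc j) \<pi>. proc js i"
  let ?D = "\<lambda>\<pi> j. \<Sum>i\<leftarrow>take (Suc j) \<pi>. det js i"
  \<comment> \<open>The completion time at position \<open>j\<close>, as in
    \<open>order_cost_eq_sum\<close> with \<open>P = 0\<close> and \<open>N = ML0\<close>.\<close>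
  let ?c = "\<lambda>\<pi> j. 0 + ?P \<pi> j + max 0 (?D \<pi> j - ML0)"
  note nonneg = pMA_instanceD(1)[OF inst \<sigma>(1)] pMA_instanceD(1)[OF inst \<pi>]
  note perm\<sigma> = mset_eq_upt_imp[OF \<sigma>(1)] and perm\<pi> = mset_eq_upt_imp[OF \<pi>]
  have len\<tau>: "length \<tau> = m"
    using mset_eq_length[OF \<tau>(1)] m(1) perm\<sigma>(3) by simp
  have nonneg\<tau>: "\<forall>i\<in>set \<tau>. 0 \<le> det js i"
    using mset_eq_setD[OF \<tau>(1)] nonneg(1) by (auto dest: in_set_takeD)
  have nonneg_c: "0 \<le> ?c \<pi> j" for j
    using nonneg(2) by (auto intro!: add_nonneg_nonneg sum_list_nonneg dest!: in_set_takeD)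

  \<comment> \<open>The filtered list holds the jobs of \<open>\<tau>\<close> in the order in which
    \<open>\<pi>\<close> processes them.\<close>
  have filter: "mset (filter (\<lambda>i. i \<in> set \<tau>) \<pi>) = mset \<tau>"
  proof (rule set_eq_iff_mset_eq_distinct[THEN iffD1])
    show "distinct (filter (\<lambda>i. i \<in> set \<tau>) \<pi>)"
      using perm\<pi> by simp
    show "distinct \<tau>"
      using perm\<sigma>(1) mset_eq_imp_distinct_iff[OF \<tau>(1)] by simp
    show "set (filter (\<lambda>i. i \<in> set \<tau>) \<pi>) = set \<tau>"
      using mset_eq_setD[OF \<tau>(1)] perm\<sigma>(2) perm\<pi>(2) set_take_subset[of m \<sigma>] by auto
  qed

  \<comment> \<open>The first \<open>m\<close> jobs together deteriorate by at most
    \<open>ML0\<close>, so the maximum vanishes.\<close>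
  have "?c ?\<rho> j = ?P \<tau> j" if "j < m" for j
  proof -
    have "?D \<tau> j \<le> (\<Sum>i\<leftarrow>take m \<tau>. det js i)"
      using that nonneg\<tau> by (intro sum_list_take_mono) auto
    also have "\<dots> = (\<Sum>i\<leftarrow>take m \<sigma>. det js i)"
      using sum_list_map_mset_eq[OF \<tau>(1)] len\<tau> by simp
    finally show ?thesis
      using that len\<tau> m(2) by simp
  qed
  then have "(\<Sum>j<m. ?c ?\<rho> j) = (\<Sum>j<m. 0 + ?P \<tau> j)"
    by (intro sum.cong) auto
  also have "\<dots> \<le> (\<Sum>j<m. 0 + ?P (filter (\<lambda>i. i \<in> set \<tau>) \<pi>) j)"
    using filter by (intro sum_mono add_mono sum_list_take_sorted_le \<tau>(2)) auto
  also have "\<dots> \<le> order_cost js 0 ML0 \<pi>"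
  proof -
    have "length (filter (\<lambda>i. i \<in> set \<tau>) \<pi>) = m"
      using mset_eq_length[OF filter] len\<tau> by simp
    then show ?thesis
      using order_cost_filter_le[of \<pi> js 0 0 "\<lambda>i. i \<in> set \<tau>" ML0] nonneg(2) by simp
  qed
  finally have head: "(\<Sum>j<m. ?c ?\<rho> j) \<le> order_cost js 0 ML0 \<pi>" .

  have "?c ?\<rho> j \<le> ?c \<pi> j" if "m \<le> j" "j < ?n" for j
  proof -
    \<comment> \<open>Re-sorting the first \<open>m\<close> jobs leaves longer prefixes unchanged as
      multisets.\<close>
    have eq: "mset (take (Suc j) ?\<rho>) = mset (take (Suc j) \<sigma>)"
    proof -
      have "take (Suc j) \<sigma> = take m \<sigma> @ take (Suc j - m) (drop m \<sigma>)"
        using that by (metis le_Suc_eq le_add_diff_inverse take_add)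
      then show ?thesis
        using that len\<tau> \<tau>(1) by simp
    qed
    \<comment> \<open>Hence the maximum is its second argument, and processing time and
      deterioration merge into one sum.\<close>
    have "ML0 \<le> ?D \<sigma> j"
      using m(3) that nonneg(1) sum_list_take_mono[of \<sigma> "det js" "Suc m" "Suc j"] by auto
    moreover have "?P ?\<rho> j = ?P \<sigma> j" "?D ?\<rho> j = ?D \<sigma> j"
      by (rule sum_list_map_mset_eq[OF eq])+
    ultimately have "?c ?\<rho> j = (\<Sum>i\<leftarrow>take (Suc j) \<sigma>. proc js i + det js i) - ML0"
      unfolding sum_list_addf by linarith
    also have "\<dots> \<le> (\<Sum>i\<leftarrow>take (Suc j) \<pi>. proc js i + det js i) - ML0"
      using sum_list_take_sorted_le[of \<pi> \<sigma>] \<sigma> \<pi> by simp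
    also have "\<dots> \<le> ?c \<pi> j"
      by (simp add: sum_list_addf)
    finally show ?thesis .
  qed
  then have "(\<Sum>j\<in>{m..<?n}. ?c ?\<rho> j) \<le> (\<Sum>j\<in>{m..<?n}. ?c \<pi> j)"
    by (intro sum_mono) auto
  also have "\<dots> \<le> (\<Sum>j<?n. ?c \<pi> j)"
    using nonneg_c by (intro sum_mono2) auto
  also have "\<dots> = order_cost js 0 ML0 \<pi>"
    by (simp add: order_cost_eq_sum perm\<pi>(3))
  finally have tail: "(\<Sum>j\<in>{m..<?n}. ?c ?\<rho> j) \<le> order_cost js 0 ML0 \<pi>" .

  have "order_cost js 0 ML0 ?\<rho> = (\<Sum>j<?n. ?c ?\<rho> j)"
    using len\<tau> m(1) perm\<sigma>(3) by (simp add: order_cost_eq_sum)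
  also have "\<dots> = (\<Sum>j<m. ?c ?\<rho> j) + (\<Sum>j\<in>{m..<?n}. ?c ?\<rho> j)"
    using m(1) by (metis (no_types, lifting) atLeast0LessThan less_imp_le_nat sum.atLeastLessThan_concat zero_le)
  finally show ?thesis
    using head tail by linarith
qed

text \<open>An output is a tight schedule for the order \<open>\<tau> @ drop m \<sigma>\<close>, so
  the bound on order costs applies.\<close>

lemma A1_output_approximation:
  assumes inst: "pMA_instance js ML0 MLmax" and out: "A1_output js ML0 S"
  shows "feasible js ML0 MLmax S" and "total_completion_time js S \<le> 2 * OPT js ML0 MLmax"
proof -
  obtain \<sigma> \<tau> k where \<sigma>: "mset \<sigma> = mset [0..<length js]" "sorted (map (\<lambda>i. proc js i + det js i) \<sigma>)"
    and k: "k = Max {k \<in> {1..length js}. (\<Sum>i\<leftarrow>take (k - 1) \<sigma>. det js i) \<le> ML0}"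
    and \<tau>: "mset \<tau> = mset (take (k - 1) \<sigma>)" "sorted (map (proc js) \<tau>)"
    and S: "S = map Job \<tau> @ [MA ((\<Sum>i\<leftarrow>take k \<sigma>. det js i) - ML0), Job (\<sigma> ! (k - 1))] @
            concat (map (\<lambda>i. [MA (det js i), Job i]) (drop k \<sigma>))"
    using out unfolding A1_output_def by (elim exE conjE) (rule that)
  note i\<sigma> = pMA_instanceD[OF inst \<sigma>(1)] and len = mset_eq_upt_imp(3)[OF \<sigma>(1)]
  have K: "1 \<le> k" "k \<le> length \<sigma>" "(\<Sum>i\<leftarrow>take (k - 1) \<sigma>. det js i) \<le> ML0"
    "k < length \<sigma> \<longrightarrow> ML0 < (\<Sum>i\<leftarrow>take k \<sigma>. det js i)"
    using separation_index_iff[of \<sigma> "det js" ML0 k] i\<sigma> k len by auto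
  define m where "m = k - 1"
  have k_m: "k = Suc m"
    using K(1) by (simp add: m_def)
  have m: "m < length js" "(\<Sum>i\<leftarrow>take m \<sigma>. det js i) \<le> ML0"
      "ML0 \<le> (\<Sum>i\<leftarrow>take (Suc m) \<sigma>. det js i)"
  proof -
    show "m < length js" "(\<Sum>i\<leftarrow>take m \<sigma>. det js i) \<le> ML0"
      using K len by (auto simp: k_m)
    \<comment> \<open>When the separation job is last, maximality says nothing; the assumption that
      \<open>ML0\<close> is below the total deterioration fills in.\<close>
    show "ML0 \<le> (\<Sum>i\<leftarrow>take (Suc m) \<sigma>. det js i)"
      using K(4) i\<sigma>(4) unfolding k_m by (cases "Suc m < length \<sigma>") simp_all
  qed
  have \<tau>': "mset \<tau> = mset (take m \<sigma>)"
    using \<tau>(1) by (simp add: m_def)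
  have sum\<tau>: "(\<Sum>i\<leftarrow>\<tau>. det js i) = (\<Sum>i\<leftarrow>take m \<sigma>. det js i)"
    using \<tau>' by (rule sum_list_map_mset_eq)
  have nth: "take (Suc m) \<sigma> = take m \<sigma> @ [\<sigma> ! m]" "drop m \<sigma> = \<sigma> ! m # drop (Suc m) \<sigma>"
    using m(1) len by (simp_all add: take_Suc_conv_app_nth Cons_nth_drop_Suc)
  \<comment> \<open>The first activity supplies what the separation job needs beyond the level left
    by \<open>\<tau>\<close>.\<close>
  have "tight js (ML0 - (\<Sum>i\<leftarrow>\<tau>. det js i)) (drop m \<sigma>)
     (MA (det js (\<sigma> ! m) - (ML0 - (\<Sum>i\<leftarrow>\<tau>. det js i))) # Job (\<sigma> ! m) #
       concat (map (\<lambda>i. [MA (det js i), Job i]) (drop (Suc m) \<sigma>)))"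
    unfolding nth(2) using m(3) nth(1) sum\<tau> i\<sigma>(1)
    by (intro tight.MA tight_concat_MA_Job) (auto dest: in_set_dropD)
  then have "tight js ML0 (\<tau> @ drop m \<sigma>) S"
    unfolding S k_m using m(2) sum\<tau> nth(1) i\<sigma>(1) mset_eq_setD[OF \<tau>']
    by (intro tight_map_Job_append) (auto dest: in_set_takeD simp: algebra_simps)
  moreover have "mset (\<tau> @ drop m \<sigma>) = mset [0..<length js]"
    using \<tau>' \<sigma>(1) by (metis append_take_drop_id mset_append)
  ultimately have fin: "feasible js ML0 MLmax S"
    "total_completion_time js S = order_cost js 0 ML0 (\<tau> @ drop m \<sigma>)"
    using tight_feasible[OF inst] by blast+
  show "feasible js ML0 MLmax S" by fact
  obtain \<pi> where \<pi>: "mset \<pi> = mset [0..<length js]" "OPT js ML0 MLmax = order_cost js 0 ML0 \<pi>"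
    using OPT_attained[OF inst] .
  show "total_completion_time js S \<le> 2 * OPT js ML0 MLmax"
    using order_cost_le_twice[OF inst \<sigma> \<tau>' \<tau>(2) m \<pi>(1)] fin(2) \<pi>(2) by simp
qed

section \<open>The implementation\<close>

lemmas timed_simps = bind_timed_def return_timed_def call_def add_timed_def sub_timed_def le_timed_def

section \<open>Merge sort\<close>

lemma split_timed_mset:
  "mset (fst (result (split_timed xs))) + mset (snd (result (split_timed xs))) = mset xs"
  by (induction xs) (auto simp: timed_simps add.commute split: prod.splits)

lemma split_timed_steps: "steps (split_timed xs) = length xs + 1"
  by (induction xs) (auto simp: timed_simps split: prod.splits)

lemma merge_timed_mset: "mset (result (merge_timed key xs ys)) = mset xs + mset ys"
  by (induction key xs ys rule: merge_timed.induct) (auto simp: timed_simps)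

lemma merge_timed_sorted:
  assumes "sorted (map (\<lambda>x. result (key x)) xs)" and "sorted (map (\<lambda>x. result (key x)) ys)"
  shows "sorted (map (\<lambda>x. result (key x)) (result (merge_timed key xs ys)))"
  using assms
proof (induction key xs ys rule: merge_timed.induct)
  case (3 key x xs y ys)
  have "set (result (merge_timed key us vs)) = set us \<union> set vs" for us vs
    by (metis merge_timed_mset set_mset_mset set_mset_union)
  then show ?case
    using 3 by (auto simp: timed_simps)
qed (auto simp: timed_simps)

text \<open>Placing one element costs at most 6: the call, two keys of at most 2 steps each and a
  comparison. The final call adds 1.\<close>

lemma merge_timed_steps:
  assumes "\<And>x. steps (key x) \<le> 2"
  shows "steps (merge_timed key xs ys) \<le> 6 * (length xs + length ys) + 1"
  using assms
proof (induction key xs ys rule: merge_timed.induct)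
  case (3 key x xs y ys)
  note IH = "3.IH"[OF refl refl refl refl _ 3(3)]
  have "steps (key x) \<le> 2" "steps (key y) \<le> 2"
    by (rule 3(3))+
  then show ?case
    using IH by (cases "result (key x) \<le> result (key y)") (simp_all add: timed_simps)
qed (auto simp: timed_simps)

lemma msort_timed_correct:
  "mset (result (msort_timed key xs)) = mset xs \<and>
   sorted (map (\<lambda>x. result (key x)) (result (msort_timed key xs)))"
proof (induction key xs rule: msort_timed.induct)
  case (3 key x y xs)
  obtain us vs where uv: "result (split_timed (x # y # xs)) = (us, vs)"
    by fastforce
  have "result (msort_timed key (x # y # xs)) =
      result (merge_timed key (result (msort_timed key us)) (result (msort_timed key vs)))"
    unfolding msort_timed.simps bind_timed_def uv by simp
  moreover have "mset us + mset vs = mset (x # y # xs)"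
    using split_timed_mset[of "x # y # xs"] uv by simp
  moreover note "3.IH"(1)[of "()" "(us, vs)" us vs] "3.IH"(2)[of "()" "(us, vs)" us vs]
  ultimately show ?case
    using uv by (simp add: merge_timed_mset merge_timed_sorted call_def)
qed (auto simp: timed_simps)

text \<open>\<open>d\<close> bounds the recursion depth, which keeps logarithms out of the
  induction.\<close>

lemma msort_timed_steps:
  assumes "\<And>x. steps (key x) \<le> 2" and "length xs \<le> 2 ^ d"
  shows "steps (msort_timed key xs) \<le> 9 * length xs * d + 1"
  using assms(2)
proof (induction d arbitrary: xs)
  case 0
  then show ?case
    by (cases xs) (auto simp: timed_simps)
next
  case (Suc d)
  show ?case
  proof (cases "length xs < 2")
    case True
    then show ?thesis
      by (cases xs; cases "tl xs") (auto simp: timed_simps)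
  next
    case False
    then obtain x y zs where xs: "xs = x # y # zs"
      by (cases xs; cases "tl xs") auto
    obtain us vs where uv: "result (split_timed xs) = (us, vs)"
      by fastforce
    have len: "length us = (length xs + 1) div 2" "length vs = length xs div 2"
      using length_split_timed[of xs] uv by auto
    \<comment> \<open>Even the half rounded up has length at most \<open>2 ^ d\<close>.\<close>
    have us: "steps (msort_timed key us) \<le> 9 * length us * d + 1"
      using Suc.prems len by (intro Suc.IH) auto
    have vs: "steps (msort_timed key vs) \<le> 9 * length vs * d + 1"
      using Suc.prems len by (intro Suc.IH) auto
    have sum: "length us + length vs = length xs"
      using len by linarith
    have "mset (result (msort_timed key us)) = mset us" "mset (result (msort_timed key vs)) = mset vs"
      using msort_timed_correct by blast+
    then have "steps (merge_timed key (result (msort_timed key us)) (result (msort_timed key vs)))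
        \<le> 6 * length xs + 1"
      using merge_timed_steps[of key, OF assms(1)] sum mset_eq_length by metis
    moreover have "steps (msort_timed key xs) = 1 + (length xs + 1) + steps (msort_timed key us) +
        steps (msort_timed key vs) +
        steps (merge_timed key (result (msort_timed key us)) (result (msort_timed key vs)))"
      using uv split_timed_steps[of xs] unfolding xs msort_timed.simps bind_timed_def
      by (simp add: call_def)
    moreover have "9 * length us * d + 9 * length vs * d = 9 * length xs * d"
      using sum by (metis add_mult_distrib add_mult_distrib2)
    \<comment> \<open>With \<open>n = length xs\<close>, this level adds \<open>7 * n + 5\<close>,
      at most \<open>9 * n + 1\<close> because \<open>n \<ge> 2\<close>.\<close>
    ultimately show ?thesis
      using us vs False by simp
  qed
qed

section \<open>The linear passes\<close>

lemma index_timed_result: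
  "result (index_timed i js) = map (\<lambda>j. (i + j, js ! j)) [0..<length js]"
proof (induction i js rule: index_timed.induct)
  case (2 i p d js)
  have "[0..<length ((p, d) # js)] = 0 # map Suc [0..<length js]"
    by (simp add: upt_conv_Cons map_Suc_upt del: upt_Suc)
  then show ?case
    using 2 by (simp add: timed_simps del: upt_Suc)
qed (simp add: timed_simps)

lemma index_timed_steps: "steps (index_timed i js) = length js + 1"
  by (induction i js rule: index_timed.induct) (auto simp: timed_simps)

text \<open>With \<open>s = 0\<close> and \<open>k = Suc m\<close> this yields the local conditions
  of \<open>separation_index_iff\<close>. The last job is never tested, so
  \<open>m < length xs\<close>.\<close>

lemma separate_timed_result:
  assumes "xs \<noteq> []" and "s \<le> ML0"
  shows "\<exists>m<length xs. result (separate_timed ML0 s xs) =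
      (take m xs, drop m xs, s + (\<Sum>x\<leftarrow>take m xs. snd (snd x))) \<and>
    s + (\<Sum>x\<leftarrow>take m xs. snd (snd x)) \<le> ML0 \<and>
    (Suc m < length xs \<longrightarrow> ML0 < s + (\<Sum>x\<leftarrow>take (Suc m) xs. snd (snd x)))"
  using assms
proof (induction ML0 s xs rule: separate_timed.induct)
  case (2 ML0 s x)
  then show ?case by (auto simp: timed_simps)
next
  case (3 ML0 s i p d y xs)
  show ?case
  proof (cases "s + d \<le> ML0")
    case True
    with 3 obtain m where "m < length (y # xs)"
      "result (separate_timed ML0 (s + d) (y # xs)) =
        (take m (y # xs), drop m (y # xs), s + d + (\<Sum>x\<leftarrow>take m (y # xs). snd (snd x)))"
      "s + d + (\<Sum>x\<leftarrow>take m (y # xs). snd (snd x)) \<le> ML0"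
      "Suc m < length (y # xs) \<longrightarrow> ML0 < s + d + (\<Sum>x\<leftarrow>take (Suc m) (y # xs). snd (snd x))"
      by (fastforce simp: timed_simps)
    with True show ?thesis
      by (intro exI[of _ "Suc m"]) (auto simp: timed_simps)
  next
    case False
    \<comment> \<open>The head already exceeds the level and becomes the separation job, so the
      prefix is empty.\<close>
    then show ?thesis
      using 3(3) by (intro exI[of _ 0]) (auto simp: timed_simps)
  qed
qed simp

lemma separate_timed_steps: "steps (separate_timed ML0 s xs) \<le> 3 * length xs + 1"
  by (induction ML0 s xs rule: separate_timed.induct) (auto simp: timed_simps split: prod.splits)

lemma emit_jobs_timed_result: "result (emit_jobs_timed xs S) = map Job (map fst xs) @ S"
  by (induction xs S rule: emit_jobs_timed.induct) (auto simp: timed_simps)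

lemma emit_jobs_timed_steps: "steps (emit_jobs_timed xs S) = length xs + 1"
  by (induction xs S rule: emit_jobs_timed.induct) (auto simp: timed_simps)

lemma emit_MA_jobs_timed_result:
  "result (emit_MA_jobs_timed xs) = concat (map (\<lambda>(i, p, d). [MA d, Job i]) xs)"
  by (induction xs rule: emit_MA_jobs_timed.induct) (auto simp: timed_simps)

lemma emit_MA_jobs_timed_steps: "steps (emit_MA_jobs_timed xs) = length xs + 1"
  by (induction xs rule: emit_MA_jobs_timed.induct) (auto simp: timed_simps)

lemma emit_from_separation_timed_steps:
  "steps (emit_from_separation_timed ML0 s xs) \<le> length xs + 4"
  by (cases "(ML0, s, xs)" rule: emit_from_separation_timed.cases)
     (auto simp: timed_simps emit_MA_jobs_timed_steps)

lemma sum_key_simps: "result (sum_key x) = fst (snd x) + snd (snd x)" "steps (sum_key x) = 2"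
  by (cases x; simp add: timed_simps)+

lemma proc_key_simps: "result (proc_key x) = fst (snd x)" "steps (proc_key x) = 1"
  by (cases x; simp add: timed_simps)+

text \<open>The witnesses \<open>\<sigma>\<close> and \<open>\<tau>\<close> are the indices of the
  two sorted lists of triples.\<close>

lemma A1_output_A1:
  assumes inst: "pMA_instance js ML0 MLmax"
  shows "A1_output js ML0 (result (A1 js ML0))"
proof -
  define xs where "xs = result (index_timed 0 js)"
  define ys where "ys = result (msort_timed sum_key xs)"
  define \<sigma> where "\<sigma> = map fst ys"
  have xs: "xs = map (\<lambda>j. (j, js ! j)) [0..<length js]"
    by (simp add: xs_def index_timed_result)
  have ys: "mset ys = mset xs" "sorted (map (\<lambda>x. fst (snd x) + snd (snd x)) ys)"
    using msort_timed_correct[of sum_key xs] by (auto simp: ys_def sum_key_simps)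
  \<comment> \<open>Each triple still carries the data of its own index, so keys and sums over
    triples become those over indices.\<close>
  have snd_ys: "snd x = js ! fst x" if "x \<in> set ys" for x
    using that mset_eq_setD[OF ys(1)] by (auto simp: xs)
  have \<sigma>: "mset \<sigma> = mset [0..<length js]"
    unfolding \<sigma>_def mset_map ys(1) by (simp add: xs flip: mset_map del: mset_upt) (simp add: comp_def)
  note i\<sigma> = pMA_instanceD[OF inst \<sigma>] and len = mset_eq_upt_imp(3)[OF \<sigma>]
  have "map (\<lambda>i. proc js i + det js i) \<sigma> = map (\<lambda>x. fst (snd x) + snd (snd x)) ys"
    by (simp add: \<sigma>_def snd_ys)
  then have sorted\<sigma>: "sorted (map (\<lambda>i. proc js i + det js i) \<sigma>)"
    using ys(2) by simp
  have sum_take: "(\<Sum>x\<leftarrow>take l ys. snd (snd x)) = (\<Sum>i\<leftarrow>take l \<sigma>. det js i)" for l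
    unfolding \<sigma>_def take_map map_map
    by (intro arg_cong[of _ _ sum_list] map_cong refl) (metis comp_apply in_set_takeD snd_ys)
  obtain m where m: "m < length ys"
    and sep: "result (separate_timed ML0 0 ys) =
      (take m ys, drop m ys, \<Sum>i\<leftarrow>take m \<sigma>. det js i)"
    and le: "(\<Sum>i\<leftarrow>take m \<sigma>. det js i) \<le> ML0"
    and less: "Suc m < length ys \<longrightarrow> ML0 < (\<Sum>i\<leftarrow>take (Suc m) \<sigma>. det js i)"
    using separate_timed_result[of ys 0 ML0] i\<sigma>(2,5) by (auto simp: \<sigma>_def[symmetric] sum_take) (auto simp: \<sigma>_def)
  have len_ys: "length ys = length js"
    using len by (simp add: \<sigma>_def)
  define us where "us = result (msort_timed proc_key (take m ys))"
  define \<tau> where "\<tau> = map fst us"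
  have us: "mset us = mset (take m ys)" "sorted (map (\<lambda>x. fst (snd x)) us)"
    using msort_timed_correct[of proc_key "take m ys"] by (auto simp: us_def proc_key_simps)
  have "snd x = js ! fst x" if "x \<in> set us" for x
    using that mset_eq_setD[OF us(1)] by (intro snd_ys) (auto dest: in_set_takeD)
  then have "map (proc js) \<tau> = map (\<lambda>x. fst (snd x)) us"
    by (simp add: \<tau>_def)
  then have sorted\<tau>: "sorted (map (proc js) \<tau>)"
    using us(2) by simp
  have \<tau>: "mset \<tau> = mset (take m \<sigma>)"
    using us(1) by (simp add: \<tau>_def \<sigma>_def take_map)
  have k: "Suc m = Max {k \<in> {1..length js}. (\<Sum>i\<leftarrow>take (k - 1) \<sigma>. det js i) \<le> ML0}"
    using separation_index_iff[of \<sigma> "det js" ML0 "Suc m"] i\<sigma> len m len_ys le less by auto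
  have drop_ys: "drop m ys = (\<sigma> ! m, js ! (\<sigma> ! m)) # drop (Suc m) ys"
    using m snd_ys[of "ys ! m"] by (simp add: \<sigma>_def Cons_nth_drop_Suc[symmetric] prod_eq_iff)
  have sum_Suc: "(\<Sum>i\<leftarrow>take m \<sigma>. det js i) + det js (\<sigma> ! m) = (\<Sum>i\<leftarrow>take (Suc m) \<sigma>. det js i)"
    using m len_ys len by (simp add: take_Suc_conv_app_nth)
  have concat: "concat (map (\<lambda>(i, p, d). [MA d, Job i]) (drop (Suc m) ys)) =
      concat (map (\<lambda>i. [MA (det js i), Job i]) (drop (Suc m) \<sigma>))"
    unfolding \<sigma>_def drop_map map_map
    by (intro arg_cong[of _ _ concat] map_cong refl)
       (metis (no_types, lifting) case_prod_beta comp_apply in_set_dropD snd_ys)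
  obtain p d where pd: "js ! (\<sigma> ! m) = (p, d)"
    by fastforce
  have emit: "result (emit_from_separation_timed ML0 (\<Sum>i\<leftarrow>take m \<sigma>. det js i) (drop m ys)) =
     [MA ((\<Sum>i\<leftarrow>take (Suc m) \<sigma>. det js i) - ML0), Job (\<sigma> ! m)] @
     concat (map (\<lambda>i. [MA (det js i), Job i]) (drop (Suc m) \<sigma>))"
    unfolding drop_ys pd emit_from_separation_timed.simps
    using sum_Suc concat pd by (simp add: timed_simps emit_MA_jobs_timed_result)
  have "result (A1 js ML0) = map Job \<tau> @
     [MA ((\<Sum>i\<leftarrow>take (Suc m) \<sigma>. det js i) - ML0), Job (\<sigma> ! (Suc m - 1))] @
     concat (map (\<lambda>i. [MA (det js i), Job i]) (drop (Suc m) \<sigma>))"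
    unfolding A1_def bind_timed_def
    using emit by (simp add: xs_def[symmetric] ys_def[symmetric] sep us_def[symmetric]
        emit_jobs_timed_result \<tau>_def del: map_map)
  moreover have "mset \<tau> = mset (take (Suc m - 1) \<sigma>)"
    using \<tau> by simp
  ultimately show ?thesis
    unfolding A1_output_def using \<sigma> sorted\<sigma> k sorted\<tau> by blast
qed

section \<open>Running time\<close>

lemma A1_steps:
  assumes inst: "pMA_instance js ML0 MLmax" and d: "length js \<le> 2 ^ d"
  shows "steps (A1 js ML0) \<le> 18 * length js * d + 6 * length js + 10"
proof -
  define xs where "xs = result (index_timed 0 js)"
  define ys where "ys = result (msort_timed sum_key xs)"
  obtain us vs s where sep: "result (separate_timed ML0 0 ys) = (us, vs, s)"
    using prod_cases3 by blast
  have len: "length xs = length js" "length ys = length js"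
    using mset_eq_length[OF conjunct1[OF msort_timed_correct[of sum_key xs]]]
    by (simp_all add: xs_def ys_def index_timed_result)
  have "ys \<noteq> []" "0 \<le> ML0"
    using pMA_instanceD(2,5)[OF inst refl] len(2) by auto
  then have uv: "length us + length vs = length js"
    using separate_timed_result[of ys 0 ML0] sep len by auto
  have len_us: "length (result (msort_timed proc_key us)) = length us"
    using msort_timed_correct by (blast intro: mset_eq_length)
  have "steps (msort_timed sum_key xs) \<le> 9 * length js * d + 1"
    using msort_timed_steps[of sum_key xs d] d len by (simp add: sum_key_simps)
  moreover have "steps (msort_timed proc_key us) \<le> 9 * length js * d + 1"
  proof -
    have "steps (msort_timed proc_key us) \<le> 9 * length us * d + 1"
      using msort_timed_steps[of proc_key us d] d uv by (simp add: proc_key_simps)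
    also have "\<dots> \<le> 9 * length js * d + 1"
      using uv by simp
    finally show ?thesis .
  qed
  moreover have "steps (separate_timed ML0 0 ys) \<le> 3 * length js + 1"
    using separate_timed_steps[of ML0 0 ys] len by simp
  moreover have "steps (emit_from_separation_timed ML0 s vs) \<le> length vs + 4"
    by (rule emit_from_separation_timed_steps)
  moreover have "steps (A1 js ML0) = 1 + (length js + 1) + steps (msort_timed sum_key xs) +
      steps (separate_timed ML0 0 ys) + steps (msort_timed proc_key us) +
      steps (emit_from_separation_timed ML0 s vs) + (length us + 1)"
    unfolding A1_def bind_timed_def
    by (simp add: xs_def[symmetric] ys_def[symmetric] sep index_timed_steps emit_jobs_timed_steps
        len_us call_def)
  \<comment> \<open>As \<open>us\<close> and \<open>vs\<close> share the \<open>n\<close> jobs, the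
    linear passes contribute \<open>5 * n\<close> besides constants.\<close>
  ultimately show ?thesis
    using uv by linarith
qed

lemma A1_steps_log:
  assumes "pMA_instance js ML0 MLmax"
  shows "real (steps (A1 js ML0)) \<le>
    18 * real (length js) * (log 2 (real (length js)) + 1) + 6 * real (length js) + 10"
proof -
  let ?n = "length js"
  have n: "?n > 0"
    using pMA_instanceD(5)[OF assms refl] by simp
  \<comment> \<open>The least depth with \<open>n \<le> 2 ^ d\<close>, less than one above the
    logarithm.\<close>
  define d where "d = nat \<lceil>log 2 (real ?n)\<rceil>"
  have "0 \<le> log 2 (real ?n)"
    using n by (simp add: Suc_le_eq)
  then have d: "log 2 (real ?n) \<le> real d" "real d \<le> log 2 (real ?n) + 1"
    unfolding d_def by linarith+
  have "real ?n = 2 powr log 2 (real ?n)"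
    using n by simp
  also have "\<dots> \<le> 2 powr real d"
    using d by (intro powr_mono) auto
  also have "\<dots> = real (2 ^ d)"
    by (simp add: powr_realpow)
  finally have "?n \<le> 2 ^ d"
    by (simp only: of_nat_le_iff)
  from A1_steps[OF assms this]
  have "real (steps (A1 js ML0)) \<le> real (18 * ?n * d + 6 * ?n + 10)"
    by (simp only: of_nat_le_iff)
  also have "\<dots> = 18 * real ?n * real d + 6 * real ?n + 10"
    by simp
  also have "\<dots> \<le> 18 * real ?n * (log 2 (real ?n) + 1) + 6 * real ?n + 10"
    using d by (intro add_right_mono mult_left_mono) auto
  finally show ?thesis .
qed

theorem theorem13:
  shows "(\<exists>T :: nat \<Rightarrow> real. T \<in> O(\<lambda>n. real n * ln (real n)) \<and>
            (\<forall>js ML0 MLmax. pMA_instance js ML0 MLmax \<longrightarrow>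
               A1_output js ML0 (result (A1 js ML0)) \<and>
               real (steps (A1 js ML0)) \<le> T (length js))) \<and>
         (\<forall>js ML0 MLmax S. pMA_instance js ML0 MLmax \<and> A1_output js ML0 S \<longrightarrow>
            feasible js ML0 MLmax S \<and>
            total_completion_time js S \<le> 2 * OPT js ML0 MLmax)"
proof -
  \<comment> \<open>The bound of \<open>A1_steps_log\<close> serves as \<open>T\<close>. The
    estimate is asymptotic, so \<open>n = 1\<close>, where \<open>n * ln n\<close> vanishes, does no
    harm.\<close>
  have "(\<lambda>n. 18 * real n * (log 2 (real n) + 1) + 6 * real n + 10) \<in> O(\<lambda>n. real n * ln (real n))"
    by real_asymp
  then show ?thesis
    using A1_output_A1 A1_steps_log A1_output_approximation by blast
qed

end
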